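(* For all integers $n\geq 1$, $ac_0(n)=2\cdot f_3(n-2)$.
   Context: A composition of $n$ of length $s$ is a sequence $\sigma=(\sigma_1,\ldots,\sigma_s)$ of positive integers with $\sum_i\sigma_i=n$; the empty composition is the unique composition of $0$ (length $0$). A composition is anti-palindromic if $\sigma_i\neq\sigma_{s-i+1}$ for all $i$ with $i\neq\frac{s+1}{2}$ (the empty composition is vacuously anti-palindromic). $ac_0(n)$ denotes the number of anti-palindromic compositions of $n$ of even length. The tribonacci numbers are defined by $f_3(n)=0$ for $n<1$, $f_3(1)=1$, and $f_3(n)=f_3(n-1)+f_3(n-2)+f_3(n-3)$ for $n\geq 2$. *)

theory Defs
  imports Main
begin

definition compositions :: "nat \<Rightarrow> nat list set" where
  "compositions n = {xs. (\<forall>x\<in>set xs. 0 < x) \<and> sum_list xs = n}"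

text \<open>Positions are counted from 0, so position \<open>i\<close> is opposite to \<open>length xs - 1 - i\<close>,
  and the middle position, which exists for odd length only, has \<open>2 * i + 1 = length xs\<close>.\<close>

definition antipalindromic :: "'a list \<Rightarrow> bool" where
  "antipalindromic xs \<longleftrightarrow>
     (\<forall>i<length xs. 2 * i + 1 \<noteq> length xs \<longrightarrow> xs ! i \<noteq> xs ! (length xs - 1 - i))"

definition ac0 :: "nat \<Rightarrow> nat" where
  "ac0 n = card {xs \<in> compositions n. antipalindromic xs \<and> even (length xs)}"

function trib :: "int \<Rightarrow> nat" where
  "trib n = (if n < 1 then 0 else if n = 1 then 1
             else trib (n - 1) + trib (n - 2) + trib (n - 3))"
  by auto
termination by (relation "measure nat") auto

declare trib.simps [simp del]

text \<open>The cardinality in \<open>ac0\<close> is that of a finite set.\<close>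

lemma finite_compositions: "finite (compositions n)"
proof (rule finite_subset)
  show "compositions n \<subseteq> {xs. set xs \<subseteq> {..n} \<and> length xs \<le> n}"
  proof
    fix xs assume "xs \<in> compositions n"
    then have pos: "\<forall>x\<in>set xs. 0 < x" and sum: "sum_list xs = n"
      by (auto simp: compositions_def)
    from pos have "length xs \<le> sum_list xs"
      by (induction xs) force+
    with sum show "xs \<in> {xs. set xs \<subseteq> {..n} \<and> length xs \<le> n}"
      using member_le_sum_list[of _ xs] by auto
  qed
  show "finite {xs. set xs \<subseteq> {..n} \<and> length xs \<le> n}"
    by (rule finite_lists_length_le) simp
qed

end

(* Peeling the outermost pair off a nonempty antipalindromic composition of even length
   leaves another one, and swapping the pair halves the count: if b n counts those whose first
   part exceeds the last, then ac0 n = 2 * b n for n > 0.  Lowering both outer parts by 1 shows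
   that b n - b (n - 2) =: c n counts those with last part 1; lowering the first part by 1 then
   gives c n = c (n - 1) + ac0 (n - 3).  Eliminating c yields the tribonacci recurrence for b. *)

theory Submission
  imports Defs
begin

definition even_antipal :: "nat \<Rightarrow> nat list set" where
  "even_antipal n = {xs \<in> compositions n. antipalindromic xs \<and> even (length xs)}"

lemma ac0_eq_card: "ac0 n = card (even_antipal n)"
  by (simp add: ac0_def even_antipal_def)

lemma finite_even_antipal: "finite (even_antipal n)"
  by (simp add: even_antipal_def finite_compositions)

text \<open>The two end positions are opposite each other and both give \<open>a \<noteq> b\<close>.
  Every other position is a position of \<open>ys\<close> shifted by one, and the exempt middle
  position shifts along with it.\<close>

lemma antipalindromic_wrap:
  "antipalindromic (a # ys @ [b]) \<longleftrightarrow> a \<noteq> b \<and> antipalindromic ys"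
proof -
  let ?xs = "a # ys @ [b]"
  let ?P = "\<lambda>i. 2 * i + 1 \<noteq> length ?xs \<longrightarrow> ?xs ! i \<noteq> ?xs ! (length ?xs - 1 - i)"
  have "(\<forall>i<length ?xs. ?P i) \<longleftrightarrow> ?P 0 \<and> ?P (Suc (length ys)) \<and> (\<forall>i<length ys. ?P (Suc i))"
  proof -
    have "(\<forall>i<Suc (Suc k). Q i) \<longleftrightarrow> Q 0 \<and> Q (Suc k) \<and> (\<forall>i<k. Q (Suc i))" for Q k
      by (subst All_less_Suc2) (auto simp: less_Suc_eq)
    moreover have "length ?xs = Suc (Suc (length ys))"
      by simp
    ultimately show ?thesis
      by presburger
  qed
  moreover have "?P 0 \<longleftrightarrow> a \<noteq> b" "?P (Suc (length ys)) \<longleftrightarrow> a \<noteq> b"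
    by (auto simp: nth_append)
  moreover have "?P (Suc i) \<longleftrightarrow>
      (2 * i + 1 \<noteq> length ys \<longrightarrow> ys ! i \<noteq> ys ! (length ys - 1 - i))" if "i < length ys" for i
  proof -
    \<comment> \<open>The opposite of a shifted position is the shifted opposite; the bound keeps
      both lookups inside \<open>ys\<close>, away from the final \<open>b\<close>.\<close>
    have "length ?xs - 1 - Suc i = Suc (length ys - 1 - i)" "length ys - 1 - i < length ys"
      using that by auto
    then show ?thesis
      using that by (simp add: nth_append)
  qed
  ultimately show ?thesis
    unfolding antipalindromic_def by blast
qed

lemma wrap_mem_even_antipal:
  "a # ys @ [b] \<in> even_antipal n \<longleftrightarrow>
     0 < a \<and> 0 < b \<and> a \<noteq> b \<and> a + b \<le> n \<and> ys \<in> even_antipal (n - (a + b))"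
  by (auto simp: even_antipal_def compositions_def antipalindromic_wrap)

text \<open>A triple stands for \<open>a # ys @ [b]\<close>, so that changing the outer parts is a
  map on coordinates. The bound \<open>a + b \<le> n\<close> guards the truncated
  subtraction.\<close>

definition descending :: "nat \<Rightarrow> (nat \<times> nat \<times> nat list) set" where
  "descending n = {(a, b, ys). 0 < b \<and> b < a \<and> a + b \<le> n \<and> ys \<in> even_antipal (n - (a + b))}"

definition descending1 :: "nat \<Rightarrow> (nat \<times> nat \<times> nat list) set" where
  "descending1 n = {(a, b, ys) \<in> descending n. b = 1}"

lemma finite_descending: "finite (descending n)"
proof (rule inj_on_finite)
  show "inj_on (\<lambda>(a, b, ys). a # ys @ [b]) (descending n)"
    by (auto simp: inj_on_def)
  show "(\<lambda>(a, b, ys). a # ys @ [b]) ` descending n \<subseteq> even_antipal n"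
    by (auto simp: descending_def wrap_mem_even_antipal)
qed (rule finite_even_antipal)

lemma finite_descending1: "finite (descending1 n)"
  by (rule finite_subset[OF _ finite_descending]) (auto simp: descending1_def)

text \<open>Positivity of \<open>n\<close> excludes the empty composition, which has no outer pair
  to swap.\<close>

lemma card_even_antipal:
  assumes "0 < n"
  shows "card (even_antipal n) = 2 * card (descending n)"
proof -
  let ?f = "\<lambda>(a, b, ys). a # ys @ [b]" and ?g = "\<lambda>(a, b, ys). b # ys @ [a]"
  have "even_antipal n = ?f ` descending n \<union> ?g ` descending n"
  proof (rule set_eqI, rule iffI)
    fix xs
    assume xs: "xs \<in> even_antipal n"
    then have "xs \<noteq> []" and ev: "even (length xs)"
      using assms by (auto simp: even_antipal_def compositions_def)
    then obtain a zs where zs: "xs = a # zs"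
      by (cases xs) auto
    with ev have "zs \<noteq> []"
      by auto
    with zs obtain b ys where "xs = a # ys @ [b]"
      by (cases zs rule: rev_cases) auto
    with xs show "xs \<in> ?f ` descending n \<union> ?g ` descending n"
      by (cases "b < a") (force simp: wrap_mem_even_antipal descending_def image_iff add.commute)+
  qed (auto simp: wrap_mem_even_antipal descending_def add.commute)
  moreover have "?f ` descending n \<inter> ?g ` descending n = {}"
    by (auto simp: descending_def)
  moreover have "card (?f ` descending n) = card (descending n)"
    "card (?g ` descending n) = card (descending n)"
    by (auto intro!: card_image simp: inj_on_def)
  ultimately show ?thesis
    by (simp add: card_Un_disjoint finite_descending)
qed

lemma card_descending:
  "card (descending (n + 2)) = card (descending n) + card (descending1 (n + 2))"
proof -
  let ?h = "\<lambda>(a, b, ys). (Suc a, Suc b, ys)"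
  have "x \<in> descending (n + 2) \<longleftrightarrow> x \<in> ?h ` descending n \<union> descending1 (n + 2)" for x
  proof -
    obtain a b ys where x: "x = (a, b, ys)"
      by (cases x)
    show ?thesis
      unfolding x by (cases a; cases b) (force simp: descending_def descending1_def image_iff)+
  qed
  then have "descending (n + 2) = ?h ` descending n \<union> descending1 (n + 2)"
    by blast
  moreover have "?h ` descending n \<inter> descending1 (n + 2) = {}"
    by (auto simp: descending_def descending1_def)
  moreover have "card (?h ` descending n) = card (descending n)"
    by (auto intro!: card_image simp: inj_on_def)
  ultimately show ?thesis
    by (simp add: card_Un_disjoint finite_descending finite_descending1)
qed

text \<open>With last part 1, the first part can be lowered unless it is 2, its least value. In that
  case the outer pair uses up 3, and the interior is any element of
  \<open>even_antipal n\<close>.\<close>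

lemma card_descending1:
  "card (descending1 (n + 3)) = card (descending1 (n + 2)) + card (even_antipal n)"
proof -
  let ?h = "\<lambda>(a, b, ys). (Suc a, b, ys)" and ?k = "\<lambda>ys. (2::nat, 1::nat, ys)"
  have "x \<in> descending1 (n + 3) \<longleftrightarrow>
      x \<in> ?h ` descending1 (n + 2) \<union> ?k ` even_antipal n" for x
  proof -
    obtain a b ys where x: "x = (a, b, ys)"
      by (cases x)
    show ?thesis
      unfolding x
      by (cases a; cases "a = 2") (force simp: descending_def descending1_def image_iff)+
  qed
  then have "descending1 (n + 3) = ?h ` descending1 (n + 2) \<union> ?k ` even_antipal n"
    by blast
  moreover have "?h ` descending1 (n + 2) \<inter> ?k ` even_antipal n = {}"
    by (auto simp: descending_def descending1_def)
  moreover have "card (?h ` descending1 (n + 2)) = card (descending1 (n + 2))"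
    "card (?k ` even_antipal n) = card (even_antipal n)"
    by (auto intro!: card_image simp: inj_on_def)
  ultimately show ?thesis
    by (simp add: card_Un_disjoint finite_even_antipal finite_descending1)
qed

text \<open>Two instances of \<open>card_descending\<close> bring in the \<open>descending1\<close>
  counts at \<open>n + 2\<close> and \<open>n + 3\<close>, which \<open>card_descending1\<close>
  links. The additive form avoids subtraction on naturals.\<close>

lemma card_descending_recurrence:
  "card (descending (n + 3)) + card (descending n) =
     card (descending (n + 2)) + card (descending (n + 1)) + card (even_antipal n)"
  using card_descending[of n] card_descending[of "n + 1"] card_descending1[of n]
  by (simp add: eval_nat_numeral)

lemma descending_empty: "n < 3 \<Longrightarrow> descending n = {}"
  by (auto simp: descending_def)

lemma card_even_antipal_0: "card (even_antipal 0) = 1"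
proof -
  have "even_antipal 0 = {[]}"
  proof (rule set_eqI)
    fix xs show "xs \<in> even_antipal 0 \<longleftrightarrow> xs \<in> {[]}"
      by (cases xs) (auto simp: even_antipal_def compositions_def antipalindromic_def)
  qed
  then show ?thesis
    by simp
qed

lemma card_descending_eq_trib: "card (descending n) = trib (int n - 2)"
proof (induction n rule: less_induct)
  case (less n)
  consider "n < 3" | "n = 3" | m where "n = m + 3" "0 < m"
    by (metis add.commute gr_zeroI le_add_diff_inverse not_less add_0)
  then show ?case
  proof cases
    case 1
    then show ?thesis
      by (simp add: descending_empty trib.simps)
  next
    \<comment> \<open>The empty interior makes the last term of the recurrence 1 here, which
      supplies the initial value \<open>trib 1\<close>.\<close>
    case 2
    then show ?thesis
      using card_descending_recurrence[of 0]
      by (simp add: descending_empty card_even_antipal_0 trib.simps)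
  next
    case 3
    \<comment> \<open>For \<open>m > 0\<close> the last term is twice
      \<open>card (descending m)\<close>, and one copy cancels against the left side.\<close>
    then have "card (descending n) =
        card (descending (m + 2)) + card (descending (m + 1)) + card (descending m)"
      using card_descending_recurrence[of m] card_even_antipal[of m] by simp
    also have "\<dots> = trib (int m) + trib (int m - 1) + trib (int m - 2)"
      using less.IH[of "m + 2"] less.IH[of "m + 1"] less.IH[of m] 3 by simp
    also have "\<dots> = trib (int n - 2)"
      \<comment> \<open>The fourth occurrence is the right-hand side; its argument is
        \<open>int m + 1\<close>, at least 2, so the recursive branch applies.\<close>
      using 3 by (subst (4) trib.simps) (simp add: algebra_simps)
    finally show ?thesis .
  qed
qed

theorem theorem1:
  fixes n :: nat
  assumes "n \<ge> 1"
  shows "ac0 n = 2 * trib (int n - 2)"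
  using assms by (simp add: ac0_eq_card card_even_antipal card_descending_eq_trib)

end
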